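(* Let $\Gamma$ be a commutative group and $T=(T,u)$ a commutative ternary $\Gamma$-semiring. Let $f,f_1,\dots,f_n\in T$ and assume $D_\Gamma(f)=\bigcup_{i=1}^n D_\Gamma(f_i)$. Then the presheaf $\mathcal{O}_T$ on principal opens, $\mathcal{O}_T(D_\Gamma(g))=T_g$, satisfies: (i) (existence of gluing) for any sections $s_i\in T_{f_i}$ ($1\le i\le n$) whose restrictions agree on each overlap $D_\Gamma(f_i)\cap D_\Gamma(f_j)=D_\Gamma(f_if_j)$ (that is, have equal images in $T_{f_if_j}$), there exists $s\in T_f$ with $s|_{D_\Gamma(f_i)}=s_i$ for all $i$; (ii) (uniqueness) such an $s$ is unique.
   Context: A commutative semiring is a tuple $(T,+,\cdot,0,1)$ with $(T,+,0)$ and $(T,\cdot,1)$ commutative monoids, multiplication distributing over addition, and $0\cdot x=x\cdot 0=0$. A commutative ternary $\Gamma$-semiring $(T,u)$ is a commutative semiring $T$ with a group homomorphism $u:\Gamma\to T^\times$, $\gamma\mapsto u_\gamma$, together with the operations $\{a\,b\,c\}_\gamma:=a b c u_\gamma$. A $\Gamma$-ideal of $T$ is a subset $I$ which is a submonoid of $(T,+,0)$ and satisfies $\{a\,b\,c\}_\gamma\in I$ for all $a\in I$, $b,c\in T$, $\gamma\in\Gamma$. A proper $\Gamma$-ideal $P$ is prime if $\{a\,b\,c\}_\gamma\in P$ implies $a\in P$ or $b\in P$ or $c\in P$, for all $a,b,c\in T$, $\gamma\in\Gamma$. $\mathrm{Spec}_\Gamma(T)$ is the set of prime $\Gamma$-ideals,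 and $D_\Gamma(f):=\{P\in\mathrm{Spec}_\Gamma(T)\mid f\notin P\}$; one has $D_\Gamma(f)\cap D_\Gamma(g)=D_\Gamma(fg)$. Localization: for $f\in T$ let $S_f=\{1,f,f^2,\dots\}$ and $T_f:=(T\times S_f)/\sim$, where $(a,s)\sim(b,t)$ iff $w a t=w b s$ for some $w\in S_f$; the class of $(a,s)$ is $\frac{a}{s}$, with $\frac as+\frac bt=\frac{at+bs}{st}$ and $\frac as\cdot\frac bt=\frac{ab}{st}$. This is a commutative semiring with canonical homomorphism $T\to T_f$, $a\mapsto\frac a1$. The presheaf is $\mathcal{O}_T(D_\Gamma(f)):=T_f$; if $D_\Gamma(g)\subseteq D_\Gamma(f)$, then the image of $f$ in $T_g$ is a unit, and the restriction map $T_f\to T_g$ is the unique semiring homomorphism compatible with the canonical maps from $T$. *)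

theory Defs
  imports "HOL-Algebra.Ring"
begin

section \<open>Commutative ternary \<open>\<Gamma>\<close>-semirings\<close>

text \<open>The zero semiring is allowed.\<close>

locale csemiring = semiring R + comm_monoid R for R (structure)

definition semiring_hom ::
  "('a, 'm) ring_scheme \<Rightarrow> ('b, 'n) ring_scheme \<Rightarrow> ('a \<Rightarrow> 'b) set" where
  "semiring_hom R S = {h \<in> ring_hom R S. h \<zero>\<^bsub>R\<^esub> = \<zero>\<^bsub>S\<^esub>}"

locale ternary_gamma_semiring =
  T: csemiring T + Gam: comm_group \<Gamma>
  for \<Gamma> :: "('g, 'k) monoid_scheme"
    and T :: "('a, 'm) ring_scheme"
    and u :: "'g \<Rightarrow> 'a" +
  assumes u_hom: "u \<in> hom \<Gamma> (units_of T)"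

definition ternary ::
  "('a, 'm) ring_scheme \<Rightarrow> ('g \<Rightarrow> 'a) \<Rightarrow> 'g \<Rightarrow> 'a \<Rightarrow> 'a \<Rightarrow> 'a \<Rightarrow> 'a" where
  "ternary T u \<gamma> a b c = a \<otimes>\<^bsub>T\<^esub> b \<otimes>\<^bsub>T\<^esub> c \<otimes>\<^bsub>T\<^esub> u \<gamma>"

definition gamma_ideal ::
  "('g, 'k) monoid_scheme \<Rightarrow> ('a, 'm) ring_scheme \<Rightarrow> ('g \<Rightarrow> 'a) \<Rightarrow> 'a set \<Rightarrow> bool" where
  "gamma_ideal \<Gamma> T u I \<longleftrightarrow>
     submonoid I (add_monoid T) \<and>
     (\<forall>a\<in>I. \<forall>b\<in>carrier T. \<forall>c\<in>carrier T. \<forall>\<gamma>\<in>carrier \<Gamma>. ternary T u \<gamma> a b c \<in> I)"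

definition prime_gamma_ideal ::
  "('g, 'k) monoid_scheme \<Rightarrow> ('a, 'm) ring_scheme \<Rightarrow> ('g \<Rightarrow> 'a) \<Rightarrow> 'a set \<Rightarrow> bool" where
  "prime_gamma_ideal \<Gamma> T u P \<longleftrightarrow>
     gamma_ideal \<Gamma> T u P \<and> P \<noteq> carrier T \<and>
     (\<forall>a\<in>carrier T. \<forall>b\<in>carrier T. \<forall>c\<in>carrier T. \<forall>\<gamma>\<in>carrier \<Gamma>.
        ternary T u \<gamma> a b c \<in> P \<longrightarrow> a \<in> P \<or> b \<in> P \<or> c \<in> P)"

definition gamma_Spec ::
  "('g, 'k) monoid_scheme \<Rightarrow> ('a, 'm) ring_scheme \<Rightarrow> ('g \<Rightarrow> 'a) \<Rightarrow> 'a set set" where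
  "gamma_Spec \<Gamma> T u = {P. prime_gamma_ideal \<Gamma> T u P}"

definition principal_open ::
  "('g, 'k) monoid_scheme \<Rightarrow> ('a, 'm) ring_scheme \<Rightarrow> ('g \<Rightarrow> 'a) \<Rightarrow> 'a \<Rightarrow> 'a set set" where
  "principal_open \<Gamma> T u f = {P \<in> gamma_Spec \<Gamma> T u. f \<notin> P}"


section \<open>Localization at an element\<close>

definition powers :: "('a, 'm) ring_scheme \<Rightarrow> 'a \<Rightarrow> 'a set" where
  "powers T f = range (\<lambda>n::nat. f [^]\<^bsub>T\<^esub> n)"

definition loc_rel :: "('a, 'm) ring_scheme \<Rightarrow> 'a \<Rightarrow> (('a \<times> 'a) \<times> ('a \<times> 'a)) set" where
  "loc_rel T f =
     {((a, s), (b, t)). a \<in> carrier T \<and> s \<in> powers T f \<and> b \<in> carrier T \<and> t \<in> powers T f \<and>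
        (\<exists>w\<in>powers T f. w \<otimes>\<^bsub>T\<^esub> a \<otimes>\<^bsub>T\<^esub> t = w \<otimes>\<^bsub>T\<^esub> b \<otimes>\<^bsub>T\<^esub> s)}"

definition frac :: "('a, 'm) ring_scheme \<Rightarrow> 'a \<Rightarrow> 'a \<Rightarrow> 'a \<Rightarrow> ('a \<times> 'a) set" where
  "frac T f a s = loc_rel T f `` {(a, s)}"

text \<open>
  Sums and products of classes are unions over all choices of representatives; the lemmas
  \<open>loc_mult_frac\<close> and \<open>loc_add_frac\<close> below show that all choices give the same class.
\<close>

definition localization :: "('a, 'm) ring_scheme \<Rightarrow> 'a \<Rightarrow> ('a \<times> 'a) set ring" where
  "localization T f =
     \<lparr>carrier = (carrier T \<times> powers T f) // loc_rel T f,
      mult = (\<lambda>X Y. \<Union>(a, s)\<in>X. \<Union>(b, t)\<in>Y. frac T f (a \<otimes>\<^bsub>T\<^esub> b) (s \<otimes>\<^bsub>T\<^esub> t)),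
      one = frac T f \<one>\<^bsub>T\<^esub> \<one>\<^bsub>T\<^esub>,
      zero = frac T f \<zero>\<^bsub>T\<^esub> \<one>\<^bsub>T\<^esub>,
      add = (\<lambda>X Y. \<Union>(a, s)\<in>X. \<Union>(b, t)\<in>Y.
               frac T f (a \<otimes>\<^bsub>T\<^esub> t \<oplus>\<^bsub>T\<^esub> b \<otimes>\<^bsub>T\<^esub> s) (s \<otimes>\<^bsub>T\<^esub> t))\<rparr>"

definition loc_map :: "('a, 'm) ring_scheme \<Rightarrow> 'a \<Rightarrow> 'a \<Rightarrow> ('a \<times> 'a) set" where
  "loc_map T f a = frac T f a \<one>\<^bsub>T\<^esub>"

text \<open>
  The semiring of sections over the principal open of \<open>f\<close> is \<open>localization T f\<close>. The map
  \<open>restriction T f g\<close> is meaningful when the principal open of \<open>g\<close> is contained in that of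
  \<open>f\<close>; the homomorphism is then unique as a function on \<open>carrier (localization T f)\<close>, and
  \<open>extensional\<close> fixes its values off the carrier.
\<close>

definition restriction ::
  "('a, 'm) ring_scheme \<Rightarrow> 'a \<Rightarrow> 'a \<Rightarrow> ('a \<times> 'a) set \<Rightarrow> ('a \<times> 'a) set" where
  "restriction T f g =
     (THE h. h \<in> semiring_hom (localization T f) (localization T g) \<and>
             h \<in> extensional (carrier (localization T f)) \<and>
             (\<forall>a\<in>carrier T. h (loc_map T f a) = loc_map T g a))"


context csemiring
begin

lemma powers_closed: "f \<in> carrier R \<Longrightarrow> s \<in> powers R f \<Longrightarrow> s \<in> carrier R"
  by (auto simp: powers_def)

lemma powers_one: "\<one> \<in> powers R f"
  unfolding powers_def by (metis nat_pow_0 rangeI)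

lemma powers_mult:
  "f \<in> carrier R \<Longrightarrow> s \<in> powers R f \<Longrightarrow> t \<in> powers R f \<Longrightarrow> s \<otimes> t \<in> powers R f"
  unfolding powers_def by (auto simp: nat_pow_mult)

lemma equiv_loc_rel:
  assumes f: "f \<in> carrier R"
  shows "equiv (carrier R \<times> powers R f) (loc_rel R f)"
proof (rule equivI)
  show "loc_rel R f \<subseteq> (carrier R \<times> powers R f) \<times> (carrier R \<times> powers R f)"
    by (auto simp: loc_rel_def)
  show "refl_on (carrier R \<times> powers R f) (loc_rel R f)"
    using powers_one by (auto simp: refl_on_def loc_rel_def)
  show "sym (loc_rel R f)"
    by (rule symI) (force simp: loc_rel_def)
  show "trans (loc_rel R f)"
  proof (rule transI)
    fix x y z assume "(x, y) \<in> loc_rel R f" "(y, z) \<in> loc_rel R f"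
    then obtain a s b t c r w v
      where xyz: "x = (a, s)" "y = (b, t)" "z = (c, r)"
        and S: "s \<in> powers R f" "t \<in> powers R f" "r \<in> powers R f" "w \<in> powers R f" "v \<in> powers R f"
        and C: "a \<in> carrier R" "b \<in> carrier R" "c \<in> carrier R"
        and w: "w \<otimes> a \<otimes> t = w \<otimes> b \<otimes> s" and v: "v \<otimes> b \<otimes> r = v \<otimes> c \<otimes> t"
      unfolding loc_rel_def by auto
    note SC = S[THEN powers_closed[OF f]]
    have "(w \<otimes> v \<otimes> t) \<otimes> a \<otimes> r = (w \<otimes> a \<otimes> t) \<otimes> (v \<otimes> r)"
      using C SC by (simp add: m_ac)
    also have "\<dots> = (v \<otimes> b \<otimes> r) \<otimes> (w \<otimes> s)"
      unfolding w using C SC by (simp add: m_ac)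
    also have "\<dots> = (w \<otimes> v \<otimes> t) \<otimes> c \<otimes> s"
      unfolding v using C SC by (simp add: m_ac)
    finally have "(w \<otimes> v \<otimes> t) \<otimes> a \<otimes> r = (w \<otimes> v \<otimes> t) \<otimes> c \<otimes> s" .
    moreover have "w \<otimes> v \<otimes> t \<in> powers R f"
      using S powers_mult[OF f] by blast
    ultimately show "(x, z) \<in> loc_rel R f"
      using S C xyz unfolding loc_rel_def by auto
  qed
qed

lemma frac_eq_iff:
  assumes "f \<in> carrier R" "a \<in> carrier R" "b \<in> carrier R" "s \<in> powers R f" "t \<in> powers R f"
  shows "frac R f a s = frac R f b t \<longleftrightarrow> (\<exists>w\<in>powers R f. w \<otimes> a \<otimes> t = w \<otimes> b \<otimes> s)"
  unfolding frac_def using assms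
  by (subst eq_equiv_class_iff[OF equiv_loc_rel[OF assms(1)]]) (auto simp: loc_rel_def)

lemma loc_mult_frac:
  assumes f: "f \<in> carrier R" and "a \<in> carrier R" "b \<in> carrier R" "s \<in> powers R f" "t \<in> powers R f"
  shows "frac R f a s \<otimes>\<^bsub>localization R f\<^esub> frac R f b t = frac R f (a \<otimes> b) (s \<otimes> t)"
proof -
  have "congruent2 (loc_rel R f) (loc_rel R f) (\<lambda>(a, s) (b, t). frac R f (a \<otimes> b) (s \<otimes> t))"
  proof (rule congruent2I')
    fix x x' y y' assume "(x, x') \<in> loc_rel R f" "(y, y') \<in> loc_rel R f"
    then obtain a s a' s' w b t b' t' v
      where xy: "x = (a, s)" "x' = (a', s')" "y = (b, t)" "y' = (b', t')"
        and S: "s \<in> powers R f" "s' \<in> powers R f" "w \<in> powers R f"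
               "t \<in> powers R f" "t' \<in> powers R f" "v \<in> powers R f"
        and C: "a \<in> carrier R" "a' \<in> carrier R" "b \<in> carrier R" "b' \<in> carrier R"
        and w: "w \<otimes> a \<otimes> s' = w \<otimes> a' \<otimes> s" and v: "v \<otimes> b \<otimes> t' = v \<otimes> b' \<otimes> t"
      unfolding loc_rel_def by auto
    note SC = S[THEN powers_closed[OF f]]
    have "(w \<otimes> v) \<otimes> (a \<otimes> b) \<otimes> (s' \<otimes> t') = (w \<otimes> a \<otimes> s') \<otimes> (v \<otimes> b \<otimes> t')"
      using C SC by (simp add: m_ac)
    also have "\<dots> = (w \<otimes> v) \<otimes> (a' \<otimes> b') \<otimes> (s \<otimes> t)"
      unfolding w v using C SC by (simp add: m_ac)
    finally show "(case x of (a, s) \<Rightarrow> \<lambda>(b, t). frac R f (a \<otimes> b) (s \<otimes> t)) y =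
        (case x' of (a, s) \<Rightarrow> \<lambda>(b, t). frac R f (a \<otimes> b) (s \<otimes> t)) y'"
      using C S f powers_mult[OF f] by (auto simp: xy frac_eq_iff intro!: bexI[of _ "w \<otimes> v"])
  qed
  from UN_equiv_class2[OF equiv_loc_rel[OF f] equiv_loc_rel[OF f] this, of "(a, s)" "(b, t)"] assms
  show ?thesis by (simp add: localization_def frac_def case_prod_unfold)
qed

lemma loc_add_frac:
  assumes f: "f \<in> carrier R" and "a \<in> carrier R" "b \<in> carrier R" "s \<in> powers R f" "t \<in> powers R f"
  shows "frac R f a s \<oplus>\<^bsub>localization R f\<^esub> frac R f b t = frac R f (a \<otimes> t \<oplus> b \<otimes> s) (s \<otimes> t)"
proof -
  have "congruent2 (loc_rel R f) (loc_rel R f)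
          (\<lambda>(a, s) (b, t). frac R f (a \<otimes> t \<oplus> b \<otimes> s) (s \<otimes> t))"
  proof (rule congruent2I')
    fix x x' y y' assume "(x, x') \<in> loc_rel R f" "(y, y') \<in> loc_rel R f"
    then obtain a s a' s' w b t b' t' v
      where xy: "x = (a, s)" "x' = (a', s')" "y = (b, t)" "y' = (b', t')"
        and S: "s \<in> powers R f" "s' \<in> powers R f" "w \<in> powers R f"
               "t \<in> powers R f" "t' \<in> powers R f" "v \<in> powers R f"
        and C: "a \<in> carrier R" "a' \<in> carrier R" "b \<in> carrier R" "b' \<in> carrier R"
        and w: "w \<otimes> a \<otimes> s' = w \<otimes> a' \<otimes> s" and v: "v \<otimes> b \<otimes> t' = v \<otimes> b' \<otimes> t"
      unfolding loc_rel_def by auto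
    note SC = S[THEN powers_closed[OF f]]
    have "(w \<otimes> v) \<otimes> (a \<otimes> t \<oplus> b \<otimes> s) \<otimes> (s' \<otimes> t') =
          (w \<otimes> a \<otimes> s') \<otimes> (v \<otimes> t \<otimes> t') \<oplus> (v \<otimes> b \<otimes> t') \<otimes> (w \<otimes> s \<otimes> s')"
      using C SC by (simp add: m_ac l_distr r_distr)
    also have "\<dots> = (w \<otimes> v) \<otimes> (a' \<otimes> t' \<oplus> b' \<otimes> s') \<otimes> (s \<otimes> t)"
      unfolding w v using C SC by (simp add: m_ac l_distr r_distr)
    finally show "(case x of (a, s) \<Rightarrow> \<lambda>(b, t). frac R f (a \<otimes> t \<oplus> b \<otimes> s) (s \<otimes> t)) y =
        (case x' of (a, s) \<Rightarrow> \<lambda>(b, t). frac R f (a \<otimes> t \<oplus> b \<otimes> s) (s \<otimes> t)) y'"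
      using C S SC f powers_mult[OF f] by (auto simp: xy frac_eq_iff intro!: bexI[of _ "w \<otimes> v"])
  qed
  from UN_equiv_class2[OF equiv_loc_rel[OF f] equiv_loc_rel[OF f] this, of "(a, s)" "(b, t)"] assms
  show ?thesis by (simp add: localization_def frac_def case_prod_unfold)
qed

end

end

theory Submission
  imports Defs
begin

text \<open>
  The argument is the one for affine schemes, arranged so that it never subtracts.

  Since every \<open>u \<gamma>\<close> is a unit, \<open>\<Gamma>\<close>-ideals and prime \<open>\<Gamma>\<close>-ideals are just the ideals and primes
  of the underlying commutative semiring (\<open>gamma_ideal_iff\<close>, \<open>prime_gamma_ideal_iff\<close>). An ideal
  that is maximal among those avoiding the powers of \<open>f\<close> is prime
  (\<open>is_prime_ideal_if_maximal_disjoint\<close>); that proof multiplies two elements of the form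
  \<open>p \<oplus> a \<otimes> x\<close> and so works over semirings. Hence, by Zorn's lemma, a power of \<open>f\<close> lies in every
  ideal that is contained in no prime of the principal open of \<open>f\<close>. Two consequences matter. If
  the principal open of \<open>g\<close> is contained in that of \<open>f\<close>, then \<open>f\<close> divides a power of \<open>g\<close>
  (\<open>saturation_if_principal_open_subset\<close>). If the principal opens of the \<open>f\<^sub>i\<close> cover that of \<open>f\<close>
  and \<open>g\<^sub>i\<close> is a power of \<open>f\<^sub>i\<close>, then some power of \<open>f\<close> is a combination \<open>\<Sum> b\<^sub>i g\<^sub>i\<close>
  (\<open>power_eq_combination_if_cover\<close>), a partition of unity.

  Uniqueness: if \<open>a / s\<close> and \<open>b / t\<close> have the same restrictions, then each \<open>f\<^sub>i\<close> has a power
  \<open>w\<^sub>i\<close> with \<open>w\<^sub>i a t = w\<^sub>i b s\<close>. Multiplying by coefficients and adding replaces the \<open>w\<^sub>i\<close> by a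
  power of \<open>f\<close>, which is the equality of the two fractions.

  Existence: by compatibility and finiteness, the sections can be written \<open>s\<^sub>i = a\<^sub>i / g\<^sub>i\<close> so that
  \<open>a\<^sub>i g\<^sub>j = a\<^sub>j g\<^sub>i\<close> holds in \<open>T\<close> itself (\<open>common_denominators\<close>). With \<open>q = \<Sum> b\<^sub>i g\<^sub>i\<close> a power of
  \<open>f\<close> and \<open>x = \<Sum> b\<^sub>i a\<^sub>i\<close> one gets \<open>x g\<^sub>j = \<Sum> b\<^sub>i g\<^sub>i a\<^sub>j = q a\<^sub>j\<close>, so \<open>x / q\<close> restricts to every
  \<open>s\<^sub>j\<close>.

  Both halves compute restrictions through a single criterion, \<open>restriction_frac_eq_iff\<close>: the
  restriction of \<open>a / s\<close> equals \<open>b / t\<close> precisely when \<open>a t\<close> and \<open>b s\<close> agree after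
  multiplication by a power of the element at which the target is localized.
\<close>


section \<open>Restriction maps\<close>

text \<open>
  The divisors of powers of \<open>g\<close>, that is, the elements that become units in the localization at
  \<open>g\<close>. Membership of \<open>f\<close> is the algebraic form of the inclusion of the principal open of \<open>g\<close> in
  that of \<open>f\<close>, so that facts on restriction need no prime ideals.
\<close>

definition saturation :: "('a, 'm) ring_scheme \<Rightarrow> 'a \<Rightarrow> 'a set" where
  "saturation T g = {s \<in> carrier T. \<exists>c\<in>carrier T. s \<otimes>\<^bsub>T\<^esub> c \<in> powers T g}"

context csemiring
begin

lemma saturation_closed: "s \<in> saturation R g \<Longrightarrow> s \<in> carrier R"
  by (simp add: saturation_def)

lemma saturationI:
  "s \<in> carrier R \<Longrightarrow> c \<in> carrier R \<Longrightarrow> s \<otimes> c \<in> powers R g \<Longrightarrow> s \<in> saturation R g"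
  by (auto simp: saturation_def)

lemma saturationE:
  assumes "s \<in> saturation R g"
  obtains c where "c \<in> carrier R" "s \<otimes> c \<in> powers R g"
  using assms by (auto simp: saturation_def)

lemma nat_pow_in_powers: "f [^] (n::nat) \<in> powers R f"
  by (simp add: powers_def)

lemma self_in_powers: "f \<in> carrier R \<Longrightarrow> f \<in> powers R f"
  using nat_pow_in_powers[of f 1] by simp

lemma powers_subset_saturation: "g \<in> carrier R \<Longrightarrow> powers R g \<subseteq> saturation R g"
  using powers_closed by (auto intro!: saturationI[of _ \<one>])

lemma saturation_mult:
  assumes g: "g \<in> carrier R" and s: "s \<in> saturation R g" and t: "t \<in> saturation R g"
  shows "s \<otimes> t \<in> saturation R g"
proof -
  obtain c d where C: "c \<in> carrier R" "d \<in> carrier R"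
    and "s \<otimes> c \<in> powers R g" "t \<otimes> d \<in> powers R g"
    using s t by (auto elim!: saturationE)
  then have "(s \<otimes> c) \<otimes> (t \<otimes> d) \<in> powers R g"
    using powers_mult[OF g] by blast
  also have "(s \<otimes> c) \<otimes> (t \<otimes> d) = (s \<otimes> t) \<otimes> (c \<otimes> d)"
    using C s t by (simp add: m_ac saturation_closed)
  finally show ?thesis
    using C s t by (intro saturationI[of _ "c \<otimes> d"]) (auto simp: saturation_closed)
qed

lemma powers_subset_saturation_of:
  assumes g: "g \<in> carrier R" and f: "f \<in> saturation R g"
  shows "powers R f \<subseteq> saturation R g"
proof -
  have "f [^] n \<in> saturation R g" for n :: nat
    using powers_one powers_subset_saturation[OF g] saturation_mult[OF g _ f]
    by (induction n) auto
  then show ?thesis by (auto simp: powers_def)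
qed

text \<open>
  A factor that becomes a unit may be cancelled just like a power of \<open>g\<close>: it can be multiplied up
  to one.
\<close>

lemma frac_eqI:
  assumes g: "g \<in> carrier R" and w: "w \<in> saturation R g"
    and ab: "a \<in> carrier R" "b \<in> carrier R" and st: "s \<in> powers R g" "t \<in> powers R g"
    and eq: "w \<otimes> a \<otimes> t = w \<otimes> b \<otimes> s"
  shows "frac R g a s = frac R g b t"
proof -
  obtain d where d: "d \<in> carrier R" "w \<otimes> d \<in> powers R g"
    using w by (rule saturationE)
  note C = ab d(1) saturation_closed[OF w] st[THEN powers_closed[OF g]]
  have "w \<otimes> d \<otimes> a \<otimes> t = d \<otimes> (w \<otimes> a \<otimes> t)"
    using C by (simp add: m_ac)
  also have "\<dots> = w \<otimes> d \<otimes> b \<otimes> s"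
    unfolding eq using C by (simp add: m_ac)
  finally show ?thesis
    using d by (auto simp: frac_eq_iff[OF g ab st])
qed

lemma frac_closed:
  "a \<in> carrier R \<Longrightarrow> s \<in> powers R f \<Longrightarrow> frac R f a s \<in> carrier (localization R f)"
  by (auto simp: localization_def frac_def intro: quotientI)

lemma localizationE:
  assumes "X \<in> carrier (localization R f)"
  obtains a s where "a \<in> carrier R" "s \<in> powers R f" "X = frac R f a s"
  using assms by (auto simp: localization_def frac_def elim: quotientE)

lemma one_localization: "\<one>\<^bsub>localization R f\<^esub> = frac R f \<one> \<one>"
  and zero_localization: "\<zero>\<^bsub>localization R f\<^esub> = frac R f \<zero> \<one>"
  by (simp_all add: localization_def)

text \<open>
  Uniqueness of restriction maps, with an explicit value: the image of \<open>a / s\<close> multiplied by \<open>s\<close>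
  must be \<open>a\<close>, and \<open>s\<close> has the inverse \<open>c / (s \<otimes> c)\<close> in the localization at \<open>g\<close>.
\<close>

lemma hom_loc_map_frac:
  assumes f: "f \<in> carrier R" and g: "g \<in> carrier R"
    and h: "h \<in> semiring_hom (localization R f) (localization R g)"
    and canonical: "\<forall>a\<in>carrier R. h (loc_map R f a) = loc_map R g a"
    and a: "a \<in> carrier R" and s: "s \<in> powers R f"
    and c: "c \<in> carrier R" "s \<otimes> c \<in> powers R g"
  shows "h (frac R f a s) = frac R g (a \<otimes> c) (s \<otimes> c)"
proof -
  note sC = powers_closed[OF f s]
  have hh: "h \<in> ring_hom (localization R f) (localization R g)"
    using h by (simp add: semiring_hom_def)
  obtain b t where b: "b \<in> carrier R" and t: "t \<in> powers R g"
    and hb: "h (frac R f a s) = frac R g b t"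
    using ring_hom_closed[OF hh frac_closed[OF a s]] by (rule localizationE)
  note tC = powers_closed[OF g t]
  have "frac R f a s \<otimes>\<^bsub>localization R f\<^esub> loc_map R f s = loc_map R f a"
    using f a s sC powers_one
    by (auto simp: loc_map_def loc_mult_frac frac_eq_iff m_ac intro!: bexI[of _ \<one>])
  then have "h (frac R f a s) \<otimes>\<^bsub>localization R g\<^esub> loc_map R g s = loc_map R g a"
    using canonical a sC ring_hom_mult[OF hh frac_closed[OF a s], of "loc_map R f s"]
      frac_closed[OF sC powers_one] by (simp add: loc_map_def)
  then have "frac R g (b \<otimes> s) t = frac R g a \<one>"
    using g b t tC sC powers_one by (simp add: hb loc_map_def loc_mult_frac)
  then obtain w where w: "w \<in> powers R g" "w \<otimes> (b \<otimes> s) = w \<otimes> a \<otimes> t"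
    using g b t sC a powers_one powers_closed[OF g] by (auto simp: frac_eq_iff)
  note wC = powers_closed[OF g w(1)]
  have "w \<otimes> b \<otimes> (s \<otimes> c) = (w \<otimes> (b \<otimes> s)) \<otimes> c"
    using wC b sC c by (simp add: m_ac)
  also have "\<dots> = w \<otimes> (a \<otimes> c) \<otimes> t"
    unfolding w(2) using wC a tC c by (simp add: m_ac)
  finally show ?thesis
    using w(1) g a b c t unfolding hb by (auto simp: frac_eq_iff)
qed

text \<open>
  The value forced by uniqueness depends neither on the representative of the fraction nor on the
  chosen complementary factor \<open>c s\<close>, so it defines a homomorphism.
\<close>

lemma ex_loc_hom:
  assumes f: "f \<in> carrier R" and g: "g \<in> carrier R" and fg: "f \<in> saturation R g"
  shows "\<exists>h\<in>semiring_hom (localization R f) (localization R g).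
           \<forall>a\<in>carrier R. h (loc_map R f a) = loc_map R g a"
proof -
  have "\<forall>s\<in>powers R f. \<exists>c. c \<in> carrier R \<and> s \<otimes> c \<in> powers R g"
    using powers_subset_saturation_of[OF g fg] by (auto elim!: saturationE)
  then obtain c where c: "\<And>s. s \<in> powers R f \<Longrightarrow> c s \<in> carrier R"
      "\<And>s. s \<in> powers R f \<Longrightarrow> s \<otimes> c s \<in> powers R g"
    by metis
  \<comment> \<open>All representatives of a class contribute the same set to the union, by \<open>same\<close>.\<close>
  define h where "h X = (\<Union>(a, s)\<in>X. frac R g (a \<otimes> c s) (s \<otimes> c s))" for X
  have same: "frac R g (a \<otimes> d) (s \<otimes> d) = frac R g (b \<otimes> e) (t \<otimes> e)"
    if "a \<in> carrier R" "b \<in> carrier R" "s \<in> powers R f" "t \<in> powers R f" "w \<in> powers R f"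
      "d \<in> carrier R" "e \<in> carrier R" "s \<otimes> d \<in> powers R g" "t \<otimes> e \<in> powers R g"
      "w \<otimes> a \<otimes> t = w \<otimes> b \<otimes> s" for a b s t w d e
  proof (rule frac_eqI[OF g, where w = w])
    note C = that(1,2,6,7) that(3-5)[THEN powers_closed[OF f]]
    show "w \<in> saturation R g"
      using that powers_subset_saturation_of[OF g fg] by blast
    have "w \<otimes> (a \<otimes> d) \<otimes> (t \<otimes> e) = (w \<otimes> a \<otimes> t) \<otimes> (d \<otimes> e)"
      using C by (simp add: m_ac)
    also have "\<dots> = w \<otimes> (b \<otimes> e) \<otimes> (s \<otimes> d)"
      unfolding that(10) using C by (simp add: m_ac)
    finally show "w \<otimes> (a \<otimes> d) \<otimes> (t \<otimes> e) = w \<otimes> (b \<otimes> e) \<otimes> (s \<otimes> d)" .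
  qed (use that in auto)
  have "congruent (loc_rel R f) (\<lambda>(a, s). frac R g (a \<otimes> c s) (s \<otimes> c s))"
  proof (rule congruentI)
    fix x y assume "(x, y) \<in> loc_rel R f"
    then obtain a s b t w where "x = (a, s)" "y = (b, t)" "a \<in> carrier R" "b \<in> carrier R"
      "s \<in> powers R f" "t \<in> powers R f" "w \<in> powers R f" "w \<otimes> a \<otimes> t = w \<otimes> b \<otimes> s"
      by (auto simp: loc_rel_def)
    then show "(case x of (a, s) \<Rightarrow> frac R g (a \<otimes> c s) (s \<otimes> c s)) =
        (case y of (a, s) \<Rightarrow> frac R g (a \<otimes> c s) (s \<otimes> c s))"
      using same[where w = w] c by simp
  qed
  note UN_equiv_class[OF equiv_loc_rel[OF f] this]
  then have h_frac': "h (frac R f a s) = frac R g (a \<otimes> c s) (s \<otimes> c s)"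
    if "a \<in> carrier R" "s \<in> powers R f" for a s
    using that by (force simp: h_def frac_def)
  have h_frac: "h (frac R f a s) = frac R g (a \<otimes> d) (s \<otimes> d)"
    if "a \<in> carrier R" "s \<in> powers R f" "d \<in> carrier R" "s \<otimes> d \<in> powers R g" for a s d
    unfolding h_frac'[OF that(1,2)]
    using that c powers_one by (intro same[where w = \<one>]) auto
  \<comment> \<open>The denominator \<open>\<one>\<close> is already a power of \<open>g\<close>, so the complementary factor can be \<open>\<one>\<close>.\<close>
  have one: "h (frac R f a \<one>) = frac R g a \<one>" if "a \<in> carrier R" for a
    using that powers_one by (subst h_frac[of _ _ \<one>]) auto
  have "h \<in> ring_hom (localization R f) (localization R g)"
  proof (rule ring_hom_memI)
    fix X assume "X \<in> carrier (localization R f)"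
    then show "h X \<in> carrier (localization R g)"
      using c powers_closed[OF f] by (auto elim!: localizationE simp: h_frac' intro!: frac_closed)
  next
    fix X Y assume "X \<in> carrier (localization R f)" "Y \<in> carrier (localization R f)"
    then obtain a s b t where X: "X = frac R f a s" and Y: "Y = frac R f b t"
      and S: "s \<in> powers R f" "t \<in> powers R f" and A: "a \<in> carrier R" "b \<in> carrier R"
      by (auto elim!: localizationE)
    note C = A S[THEN powers_closed[OF f]] S[THEN c(1)]
    have "(s \<otimes> c s) \<otimes> (t \<otimes> c t) \<in> powers R g"
      using S c powers_mult[OF g] by blast
    also have eq: "(s \<otimes> c s) \<otimes> (t \<otimes> c t) = (s \<otimes> t) \<otimes> (c s \<otimes> c t)"
      using C by (simp add: m_ac)
    finally have st: "(s \<otimes> t) \<otimes> (c s \<otimes> c t) \<in> powers R g" .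
    show "h (X \<otimes>\<^bsub>localization R f\<^esub> Y) = h X \<otimes>\<^bsub>localization R g\<^esub> h Y"
    proof -
      have "h (X \<otimes>\<^bsub>localization R f\<^esub> Y) = frac R g ((a \<otimes> b) \<otimes> (c s \<otimes> c t)) ((s \<otimes> t) \<otimes> (c s \<otimes> c t))"
        using C S f st powers_mult[OF f] by (simp add: X Y loc_mult_frac h_frac)
      also have "(a \<otimes> b) \<otimes> (c s \<otimes> c t) = (a \<otimes> c s) \<otimes> (b \<otimes> c t)"
        using C by (simp add: m_ac)
      finally show ?thesis
        using C S g c by (simp add: X Y loc_mult_frac h_frac' flip: eq)
    qed
    show "h (X \<oplus>\<^bsub>localization R f\<^esub> Y) = h X \<oplus>\<^bsub>localization R g\<^esub> h Y"
    proof -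
      have "h (X \<oplus>\<^bsub>localization R f\<^esub> Y) =
          frac R g ((a \<otimes> t \<oplus> b \<otimes> s) \<otimes> (c s \<otimes> c t)) ((s \<otimes> t) \<otimes> (c s \<otimes> c t))"
        using C S f st powers_mult[OF f] by (simp add: X Y loc_add_frac h_frac)
      also have "(a \<otimes> t \<oplus> b \<otimes> s) \<otimes> (c s \<otimes> c t)
          = (a \<otimes> c s) \<otimes> (t \<otimes> c t) \<oplus> (b \<otimes> c t) \<otimes> (s \<otimes> c s)"
        using C by (simp add: l_distr) (simp add: m_ac)
      finally show ?thesis
        using C S g c by (simp add: X Y loc_add_frac h_frac' flip: eq)
    qed
  qed (simp add: one_localization one)
  then show ?thesis
    using one by (intro bexI[of _ h]) (auto simp: semiring_hom_def zero_localization loc_map_def)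
qed

text \<open>
  The description of \<open>restriction\<close> picks out a map: existence is \<open>ex_loc_hom\<close>, cut down to the
  carrier, and uniqueness follows from \<open>hom_loc_map_frac\<close>, which also supplies the value.
\<close>

lemma restriction_frac:
  assumes f: "f \<in> carrier R" and g: "g \<in> carrier R" and fg: "f \<in> saturation R g"
    and a: "a \<in> carrier R" and s: "s \<in> powers R f"
    and c: "c \<in> carrier R" "s \<otimes> c \<in> powers R g"
  shows "restriction R f g (frac R f a s) = frac R g (a \<otimes> c) (s \<otimes> c)"
proof -
  let ?L = "carrier (localization R f)"
  let ?P = "\<lambda>h. h \<in> semiring_hom (localization R f) (localization R g) \<and> h \<in> extensional ?L \<and>
             (\<forall>a\<in>carrier R. h (loc_map R f a) = loc_map R g a)"
  obtain h where h: "h \<in> semiring_hom (localization R f) (localization R g)"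
      "\<forall>a\<in>carrier R. h (loc_map R f a) = loc_map R g a"
    using ex_loc_hom[OF f g fg] by blast
  have closed: "X \<otimes>\<^bsub>localization R f\<^esub> Y \<in> ?L" "X \<oplus>\<^bsub>localization R f\<^esub> Y \<in> ?L"
    if "X \<in> ?L" "Y \<in> ?L" for X Y
    using that f powers_mult[OF f] powers_closed[OF f]
    by (auto elim!: localizationE simp: loc_mult_frac loc_add_frac intro!: frac_closed)
  have "?P (restrict h ?L)"
    using h closed frac_closed powers_one
    by (auto simp: semiring_hom_def ring_hom_def loc_map_def one_localization zero_localization)
  moreover have "h1 = h2" if "?P h1" "?P h2" for h1 h2
  proof (rule extensionalityI)
    fix X assume "X \<in> ?L"
    then obtain a s where X: "a \<in> carrier R" "s \<in> powers R f" "X = frac R f a s"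
      by (rule localizationE)
    then obtain c where "c \<in> carrier R" "s \<otimes> c \<in> powers R g"
      using powers_subset_saturation_of[OF g fg] by (auto elim: saturationE)
    with X show "h1 X = h2 X"
      using that by (simp add: hom_loc_map_frac[OF f g])
  qed (use that in auto)
  ultimately have "\<exists>!h. ?P h" by blast
  then have "?P (restriction R f g)"
    unfolding restriction_def by (rule theI')
  then show ?thesis
    using hom_loc_map_frac[OF f g _ _ a s c] by blast
qed

text \<open>
  Here the complementary factor has disappeared: multiplying a witness by \<open>s \<otimes> c\<close>, a power of \<open>g\<close>,
  absorbs it in one direction, and multiplying the equation by \<open>c\<close> restores it in the other.
\<close>

lemma restriction_frac_eq_iff:
  assumes f: "f \<in> carrier R" and g: "g \<in> carrier R" and fg: "f \<in> saturation R g"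
    and a: "a \<in> carrier R" and s: "s \<in> powers R f"
    and b: "b \<in> carrier R" and t: "t \<in> powers R g"
  shows "restriction R f g (frac R f a s) = frac R g b t \<longleftrightarrow>
         (\<exists>w\<in>powers R g. w \<otimes> a \<otimes> t = w \<otimes> b \<otimes> s)"
proof -
  have s_sat: "s \<in> saturation R g"
    using s powers_subset_saturation_of[OF g fg] by blast
  then obtain c where c: "c \<in> carrier R" "s \<otimes> c \<in> powers R g"
    by (rule saturationE)
  note C = a b c(1) powers_closed[OF f s] powers_closed[OF g t]
  have res: "restriction R f g (frac R f a s) = frac R g (a \<otimes> c) (s \<otimes> c)"
    using assms c by (intro restriction_frac)
  show ?thesis
  proof
    assume "restriction R f g (frac R f a s) = frac R g b t"
    then obtain w where w: "w \<in> powers R g" "w \<otimes> (a \<otimes> c) \<otimes> t = w \<otimes> b \<otimes> (s \<otimes> c)"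
      using res g C t c by (auto simp: frac_eq_iff)
    note wC = powers_closed[OF g w(1)]
    have "(w \<otimes> (s \<otimes> c)) \<otimes> a \<otimes> t = (w \<otimes> (a \<otimes> c) \<otimes> t) \<otimes> s"
      using C wC by (simp add: m_ac)
    also have "\<dots> = (w \<otimes> (s \<otimes> c)) \<otimes> b \<otimes> s"
      unfolding w(2) using C wC by (simp add: m_ac)
    finally show "\<exists>w\<in>powers R g. w \<otimes> a \<otimes> t = w \<otimes> b \<otimes> s"
      using powers_mult[OF g w(1) c(2)] by blast
  next
    assume "\<exists>w\<in>powers R g. w \<otimes> a \<otimes> t = w \<otimes> b \<otimes> s"
    then obtain w where w: "w \<in> powers R g" "w \<otimes> a \<otimes> t = w \<otimes> b \<otimes> s" ..
    note wC = powers_closed[OF g w(1)]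
    have "w \<otimes> (a \<otimes> c) \<otimes> t = (w \<otimes> a \<otimes> t) \<otimes> c"
      using C wC by (simp add: m_ac)
    also have "\<dots> = w \<otimes> b \<otimes> (s \<otimes> c)"
      unfolding w(2) using C wC by (simp add: m_ac)
    finally show "restriction R f g (frac R f a s) = frac R g b t"
      unfolding res using g C t c w(1) by (auto simp: frac_eq_iff)
  qed
qed

lemma restriction_closed:
  assumes f: "f \<in> carrier R" and g: "g \<in> carrier R" and fg: "f \<in> saturation R g"
    and X: "X \<in> carrier (localization R f)"
  shows "restriction R f g X \<in> carrier (localization R g)"
proof -
  obtain a s where a: "a \<in> carrier R" and s: "s \<in> powers R f" and X: "X = frac R f a s"
    using X by (rule localizationE)
  obtain c where c: "c \<in> carrier R" "s \<otimes> c \<in> powers R g"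
    using s powers_subset_saturation_of[OF g fg] by (auto elim: saturationE)
  show ?thesis
    unfolding X restriction_frac[OF f g fg a s c] using a c by (intro frac_closed) auto
qed


text \<open>
  Comparing both restrictions with a common value \<open>b / t\<close> and eliminating \<open>b\<close> leaves a relation
  between the original fractions. Taking \<open>f' = f\<close> serves uniqueness, and two members of a cover
  with \<open>g\<close> their product serves gluing.
\<close>

lemma equal_restrictions:
  assumes C: "f \<in> carrier R" "f' \<in> carrier R" "g \<in> carrier R"
    and sat: "f \<in> saturation R g" "f' \<in> saturation R g"
    and a: "a \<in> carrier R" "a' \<in> carrier R" and s: "s \<in> powers R f" "s' \<in> powers R f'"
    and eq: "restriction R f g (frac R f a s) = restriction R f' g (frac R f' a' s')"
  shows "\<exists>w\<in>powers R g. w \<otimes> a \<otimes> s' = w \<otimes> a' \<otimes> s"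
proof -
  obtain b t where b: "b \<in> carrier R" and t: "t \<in> powers R g"
    and bt: "restriction R f' g (frac R f' a' s') = frac R g b t"
    using restriction_closed[OF C(2,3) sat(2) frac_closed[OF a(2) s(2)]] by (rule localizationE)
  obtain w where w: "w \<in> powers R g" "w \<otimes> a \<otimes> t = w \<otimes> b \<otimes> s"
    using eq C sat a s b t unfolding bt by (auto simp: restriction_frac_eq_iff)
  obtain v where v: "v \<in> powers R g" "v \<otimes> a' \<otimes> t = v \<otimes> b \<otimes> s'"
    using bt C sat a s b t by (auto simp: restriction_frac_eq_iff)
  note D = a b powers_closed[OF C(1) s(1)] powers_closed[OF C(2) s(2)]
    w(1)[THEN powers_closed[OF C(3)]] v(1)[THEN powers_closed[OF C(3)]] powers_closed[OF C(3) t]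
  have "(w \<otimes> v \<otimes> t) \<otimes> a \<otimes> s' = (w \<otimes> a \<otimes> t) \<otimes> (v \<otimes> s')"
    using D by (simp add: m_ac)
  also have "\<dots> = (v \<otimes> b \<otimes> s') \<otimes> (w \<otimes> s)"
    unfolding w(2) using D by (simp add: m_ac)
  also have "\<dots> = (w \<otimes> v \<otimes> t) \<otimes> a' \<otimes> s"
    unfolding v(2)[symmetric] using D by (simp add: m_ac)
  finally show ?thesis
    using w(1) v(1) t powers_mult[OF C(3)] by blast
qed


section \<open>Ideals and primes of a commutative semiring\<close>

text \<open>
  Addition has no inverses, so an ideal is only an additive submonoid that absorbs products.
\<close>

definition is_ideal :: "'a set \<Rightarrow> bool" where
  "is_ideal I \<longleftrightarrow> I \<subseteq> carrier R \<and> \<zero> \<in> I \<and> (\<forall>a\<in>I. \<forall>b\<in>I. a \<oplus> b \<in> I) \<and>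
     (\<forall>a\<in>I. \<forall>x\<in>carrier R. a \<otimes> x \<in> I)"

definition is_prime_ideal :: "'a set \<Rightarrow> bool" where
  "is_prime_ideal P \<longleftrightarrow> is_ideal P \<and> \<one> \<notin> P \<and>
     (\<forall>a\<in>carrier R. \<forall>b\<in>carrier R. a \<otimes> b \<in> P \<longrightarrow> a \<in> P \<or> b \<in> P)"

lemma is_ideal_mult: "is_ideal I \<Longrightarrow> a \<in> I \<Longrightarrow> x \<in> carrier R \<Longrightarrow> a \<otimes> x \<in> I"
  by (simp add: is_ideal_def)

lemma is_ideal_add: "is_ideal I \<Longrightarrow> a \<in> I \<Longrightarrow> b \<in> I \<Longrightarrow> a \<oplus> b \<in> I"
  by (simp add: is_ideal_def)

lemma is_ideal_closed: "is_ideal I \<Longrightarrow> a \<in> I \<Longrightarrow> a \<in> carrier R"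
  by (auto simp: is_ideal_def)

lemma is_ideal_zero: "is_ideal I \<Longrightarrow> \<zero> \<in> I"
  by (simp add: is_ideal_def)

lemma is_ideal_Union_chain:
  assumes "C \<noteq> {}" and chain: "subset.chain A C" and ideals: "\<And>I. I \<in> A \<Longrightarrow> is_ideal I"
  shows "is_ideal (\<Union>C)"
  unfolding is_ideal_def
proof (intro conjI ballI)
  have C: "is_ideal I" if "I \<in> C" for I
    using chain that ideals by (auto simp: subset.chain_def)
  show "\<Union>C \<subseteq> carrier R"
    using C is_ideal_closed by blast
  show "\<zero> \<in> \<Union>C"
    using C assms(1) is_ideal_zero by blast
  show "a \<otimes> x \<in> \<Union>C" if "a \<in> \<Union>C" "x \<in> carrier R" for a x
    using that C is_ideal_mult by blast
  show "a \<oplus> b \<in> \<Union>C" if ab: "a \<in> \<Union>C" "b \<in> \<Union>C" for a b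
  proof -
    obtain I J where IJ: "I \<in> C" "a \<in> I" "J \<in> C" "b \<in> J"
      using ab by blast
    then have "I \<subseteq> J \<or> J \<subseteq> I"
      using chain by (auto simp: subset.chain_def)
    with IJ C is_ideal_add show ?thesis by blast
  qed
qed

lemma is_ideal_adjoin:
  assumes I: "is_ideal I" and a: "a \<in> carrier R"
  shows "is_ideal {p \<oplus> a \<otimes> x |p x. p \<in> I \<and> x \<in> carrier R}" (is "is_ideal ?J")
  unfolding is_ideal_def
proof (intro conjI ballI)
  show "?J \<subseteq> carrier R"
    using I a is_ideal_closed by auto
  show "\<zero> \<in> ?J"
    using a is_ideal_zero[OF I] by (auto intro!: exI[of _ \<zero>])
  fix y assume "y \<in> ?J"
  then obtain p x where y: "y = p \<oplus> a \<otimes> x" "p \<in> I" "x \<in> carrier R" by blast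
  note pC = is_ideal_closed[OF I y(2)]
  show "y \<oplus> z \<in> ?J" if "z \<in> ?J" for z
  proof -
    obtain q x' where z: "z = q \<oplus> a \<otimes> x'" "q \<in> I" "x' \<in> carrier R"
      using \<open>z \<in> ?J\<close> by blast
    have "y \<oplus> z = (p \<oplus> q) \<oplus> a \<otimes> (x \<oplus> x')"
      using y z a pC is_ideal_closed[OF I z(2)] by (simp add: r_distr a_ac)
    then show ?thesis
      using y z is_ideal_add[OF I] by blast
  qed
  show "y \<otimes> r \<in> ?J" if "r \<in> carrier R" for r
  proof -
    have "y \<otimes> r = (p \<otimes> r) \<oplus> a \<otimes> (x \<otimes> r)"
      using y a pC that by (simp add: l_distr m_assoc)
    then show ?thesis
      using y that is_ideal_mult[OF I] by blast
  qed
qed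

text \<open>
  If neither \<open>a\<close> nor \<open>b\<close> is in \<open>P\<close>, then by maximality the ideals generated by \<open>P\<close> and \<open>a\<close>, and by
  \<open>P\<close> and \<open>b\<close>, contain powers of \<open>f\<close>. Their product is again a power of \<open>f\<close>, and all terms of
  its expansion lie in \<open>P\<close> once \<open>a \<otimes> b\<close> does.
\<close>

lemma is_prime_ideal_if_maximal_disjoint:
  assumes f: "f \<in> carrier R" and P: "is_ideal P" "P \<inter> powers R f = {}"
    and max: "\<And>J. is_ideal J \<Longrightarrow> P \<subseteq> J \<Longrightarrow> J \<inter> powers R f = {} \<Longrightarrow> J = P"
  shows "is_prime_ideal P"
  unfolding is_prime_ideal_def
proof (intro conjI ballI impI)
  show "\<one> \<notin> P"
    using P(2) powers_one by blast
  have meets: "\<exists>p\<in>P. \<exists>x\<in>carrier R. p \<oplus> a \<otimes> x \<in> powers R f"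
    if a: "a \<in> carrier R" "a \<notin> P" for a
  proof (rule ccontr)
    let ?J = "{p \<oplus> a \<otimes> x |p x. p \<in> P \<and> x \<in> carrier R}"
    assume "\<not> ?thesis"
    then have "?J \<inter> powers R f = {}" by blast
    moreover have "P \<subseteq> ?J"
      using is_ideal_closed[OF P(1)] a by (force intro: exI[of _ \<zero>])
    ultimately have "?J = P"
      using max is_ideal_adjoin[OF P(1) a(1)] by blast
    moreover have "a \<in> ?J"
      using is_ideal_zero[OF P(1)] a(1) by (force intro: exI[of _ \<one>])
    ultimately show False using a by blast
  qed
  fix a b assume ab: "a \<in> carrier R" "b \<in> carrier R" "a \<otimes> b \<in> P"
  show "a \<in> P \<or> b \<in> P"
  proof (rule ccontr)
    assume "\<not> (a \<in> P \<or> b \<in> P)"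
    then obtain p x q y where pq: "p \<in> P" "q \<in> P" and xy: "x \<in> carrier R" "y \<in> carrier R"
      and pow: "p \<oplus> a \<otimes> x \<in> powers R f" "q \<oplus> b \<otimes> y \<in> powers R f"
      using meets ab by meson
    note C = ab(1,2) xy pq[THEN is_ideal_closed[OF P(1)]]
    have "(p \<oplus> a \<otimes> x) \<otimes> (q \<oplus> b \<otimes> y) =
        p \<otimes> (q \<oplus> b \<otimes> y) \<oplus> (q \<otimes> (a \<otimes> x) \<oplus> (a \<otimes> b) \<otimes> (x \<otimes> y))"
      using C by (simp add: l_distr r_distr m_ac a_ac)
    also have "\<dots> \<in> P"
      using is_ideal_add[OF P(1)] is_ideal_mult[OF P(1)] C pq ab(3) by simp
    finally show False
      using P(2) powers_mult[OF f pow] by blast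
  qed
qed (rule P)

lemma ex_prime_ideal_above:
  assumes f: "f \<in> carrier R" and I: "is_ideal I" "I \<inter> powers R f = {}"
  shows "\<exists>P. is_prime_ideal P \<and> I \<subseteq> P \<and> f \<notin> P"
proof -
  define A where "A = {J. is_ideal J \<and> I \<subseteq> J \<and> J \<inter> powers R f = {}}"
  have "\<exists>M\<in>A. \<forall>X\<in>A. M \<subseteq> X \<longrightarrow> X = M"
  proof (rule subset_Zorn_nonempty)
    show "A \<noteq> {}" using I by (auto simp: A_def)
    fix C assume C: "C \<noteq> {}" "subset.chain A C"
    then have "is_ideal (\<Union>C)"
      by (rule is_ideal_Union_chain) (simp add: A_def)
    with C show "\<Union>C \<in> A"
      by (fastforce simp: A_def subset.chain_def)
  qed
  then obtain P where "P \<in> A" and max: "\<And>X. X \<in> A \<Longrightarrow> P \<subseteq> X \<Longrightarrow> X = P" by blast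
  then have P: "is_ideal P" "I \<subseteq> P" "P \<inter> powers R f = {}"
    by (auto simp: A_def)
  have "is_prime_ideal P"
    by (rule is_prime_ideal_if_maximal_disjoint[OF f]) (use P max in \<open>auto simp: A_def\<close>)
  with P self_in_powers[OF f] show ?thesis by blast
qed

lemma powers_not_in_prime_ideal:
  assumes P: "is_prime_ideal P" and f: "f \<in> carrier R" "f \<notin> P" and s: "s \<in> powers R f"
  shows "s \<notin> P"
proof -
  have "f [^] n \<notin> P" for n :: nat
    using P f by (induction n) (auto simp: is_prime_ideal_def)
  with s show ?thesis by (auto simp: powers_def)
qed

lemma is_ideal_principal:
  assumes g: "g \<in> carrier R"
  shows "is_ideal {g \<otimes> c |c. c \<in> carrier R}"
  unfolding is_ideal_def
proof (intro conjI ballI)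
  show "\<zero> \<in> {g \<otimes> c |c. c \<in> carrier R}"
    using g by (force intro: exI[of _ \<zero>])
next
  fix a b assume "a \<in> {g \<otimes> c |c. c \<in> carrier R}" "b \<in> {g \<otimes> c |c. c \<in> carrier R}"
  then obtain c d where "a = g \<otimes> c" "b = g \<otimes> d" and C: "c \<in> carrier R" "d \<in> carrier R"
    by blast
  then have "a \<oplus> b = g \<otimes> (c \<oplus> d)"
    using g by (simp add: r_distr)
  then show "a \<oplus> b \<in> {g \<otimes> c |c. c \<in> carrier R}"
    using C by blast
next
  fix a x assume "a \<in> {g \<otimes> c |c. c \<in> carrier R}" and x: "x \<in> carrier R"
  then obtain c where "a = g \<otimes> c" and c: "c \<in> carrier R"
    by blast
  then have "a \<otimes> x = g \<otimes> (c \<otimes> x)"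
    using g x by (simp add: m_assoc)
  then show "a \<otimes> x \<in> {g \<otimes> c |c. c \<in> carrier R}"
    using c x by blast
qed (use g in auto)

lemma is_ideal_span:
  assumes A: "finite A" and g: "g \<in> A \<rightarrow> carrier R"
  shows "is_ideal {\<Oplus>i\<in>A. b i \<otimes> g i |b. b \<in> A \<rightarrow> carrier R}" (is "is_ideal ?J")
  unfolding is_ideal_def
proof (intro conjI ballI)
  show "?J \<subseteq> carrier R"
    using g by (auto intro!: finsum_closed simp: Pi_iff)
  have "(\<Oplus>i\<in>A. \<zero> \<otimes> g i) = \<zero>"
    using g by (intro add.finprod_one_eqI) (simp add: Pi_iff)
  then show "\<zero> \<in> ?J"
    by (intro CollectI exI[of _ "\<lambda>_. \<zero>"]) auto
  fix y assume "y \<in> ?J"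
  then obtain b where b: "b \<in> A \<rightarrow> carrier R" and y: "y = (\<Oplus>i\<in>A. b i \<otimes> g i)" by blast
  show "y \<oplus> z \<in> ?J" if "z \<in> ?J" for z
  proof -
    obtain b' where b': "b' \<in> A \<rightarrow> carrier R" and z: "z = (\<Oplus>i\<in>A. b' i \<otimes> g i)"
      using \<open>z \<in> ?J\<close> by blast
    have "y \<oplus> z = (\<Oplus>i\<in>A. b i \<otimes> g i \<oplus> b' i \<otimes> g i)"
      unfolding y z using b b' g by (intro finsum_addf[symmetric]) auto
    also have "\<dots> = (\<Oplus>i\<in>A. (b i \<oplus> b' i) \<otimes> g i)"
      using b b' g by (intro finsum_cong') (auto simp: l_distr Pi_iff)
    finally show ?thesis
      using b b' by (intro CollectI exI[of _ "\<lambda>i. b i \<oplus> b' i"]) auto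
  qed
  show "y \<otimes> r \<in> ?J" if r: "r \<in> carrier R" for r
  proof -
    have "y \<otimes> r = (\<Oplus>i\<in>A. b i \<otimes> g i \<otimes> r)"
      unfolding y using A b g r by (intro finsum_ldistr) auto
    also have "\<dots> = (\<Oplus>i\<in>A. (b i \<otimes> r) \<otimes> g i)"
      using b r g by (intro finsum_cong') (auto simp: m_ac Pi_iff)
    finally show ?thesis
      using b r by (intro CollectI exI[of _ "\<lambda>i. b i \<otimes> r"]) auto
  qed
qed

lemma generator_in_span:
  assumes A: "finite A" and g: "g \<in> A \<rightarrow> carrier R" and j: "j \<in> A"
  shows "g j \<in> {\<Oplus>i\<in>A. b i \<otimes> g i |b. b \<in> A \<rightarrow> carrier R}"
proof -
  have "g j = (\<Oplus>i\<in>A. if j = i then g i else \<zero>)"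
    using finsum_singleton[OF j A g] by simp
  also have "\<dots> = (\<Oplus>i\<in>A. (if j = i then \<one> else \<zero>) \<otimes> g i)"
    using g by (intro finsum_cong') (auto simp: Pi_iff)
  finally show ?thesis
    by (intro CollectI exI[of _ "\<lambda>i. if j = i then \<one> else \<zero>"]) auto
qed

end


section \<open>Covers by principal opens\<close>

context ternary_gamma_semiring
begin

lemma u_one: "u \<one>\<^bsub>\<Gamma>\<^esub> = \<one>\<^bsub>T\<^esub>"
proof -
  have "u \<one>\<^bsub>\<Gamma>\<^esub> = \<one>\<^bsub>units_of T\<^esub>"
    using u_hom by (intro hom_one Gam.is_group T.units_group)
  then show ?thesis by (simp add: units_of_def)
qed

lemma u_Units: "\<gamma> \<in> carrier \<Gamma> \<Longrightarrow> u \<gamma> \<in> Units T"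
  using u_hom by (auto simp: hom_def units_of_def)

lemma ternary_one: "a \<in> carrier T \<Longrightarrow> b \<in> carrier T \<Longrightarrow> ternary T u \<one>\<^bsub>\<Gamma>\<^esub> a b \<one>\<^bsub>T\<^esub> = a \<otimes>\<^bsub>T\<^esub> b"
  by (simp add: ternary_def u_one)

text \<open>
  Absorption of ternary products at \<open>\<gamma> = \<one>\<close> with last factor \<open>\<one>\<close> is absorption of products, because
  \<open>u\<close> preserves the unit; the converse absorbs \<open>u \<gamma>\<close> as one more factor.
\<close>

lemma gamma_ideal_iff: "gamma_ideal \<Gamma> T u I \<longleftrightarrow> T.is_ideal I"
proof
  assume I: "gamma_ideal \<Gamma> T u I"
  then have sub: "submonoid I (add_monoid T)"
    by (simp add: gamma_ideal_def)
  have "a \<otimes>\<^bsub>T\<^esub> x \<in> I" if "a \<in> I" "x \<in> carrier T" for a x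
    using I that submonoid.subset[OF sub] ternary_one[of a x]
    unfolding gamma_ideal_def by (metis Gam.one_closed T.one_closed monoid.simps(1)
        partial_object.select_convs(1) subsetD)
  then show "T.is_ideal I"
    using submonoid.subset[OF sub] submonoid.one_closed[OF sub] submonoid.m_closed[OF sub]
    by (auto simp: T.is_ideal_def)
next
  assume I: "T.is_ideal I"
  have "a \<otimes>\<^bsub>T\<^esub> b \<otimes>\<^bsub>T\<^esub> c \<otimes>\<^bsub>T\<^esub> u \<gamma> \<in> I"
    if "a \<in> I" "b \<in> carrier T" "c \<in> carrier T" "\<gamma> \<in> carrier \<Gamma>" for a b c \<gamma>
    using that u_Units by (intro T.is_ideal_mult[OF I]) auto
  then show "gamma_ideal \<Gamma> T u I"
    using I by (auto simp: gamma_ideal_def ternary_def T.is_ideal_def intro!: submonoid.intro)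
qed

text \<open>
  The extra factor \<open>u \<gamma>\<close> of a ternary product is a unit and thus in no proper ideal, so primality
  never selects it.
\<close>

lemma prime_gamma_ideal_iff: "prime_gamma_ideal \<Gamma> T u P \<longleftrightarrow> T.is_prime_ideal P"
proof
  assume P: "prime_gamma_ideal \<Gamma> T u P"
  then have I: "T.is_ideal P"
    by (simp add: prime_gamma_ideal_def gamma_ideal_iff)
  have one: "\<one>\<^bsub>T\<^esub> \<notin> P"
  proof
    assume "\<one>\<^bsub>T\<^esub> \<in> P"
    then have "carrier T \<subseteq> P"
      using T.is_ideal_mult[OF I, of "\<one>\<^bsub>T\<^esub>"] by auto
    then show False
      using P T.is_ideal_closed[OF I] by (auto simp: prime_gamma_ideal_def)
  qed
  have "a \<in> P \<or> b \<in> P" if "a \<in> carrier T" "b \<in> carrier T" "a \<otimes>\<^bsub>T\<^esub> b \<in> P" for a b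
    using P one that ternary_one[of a b] unfolding prime_gamma_ideal_def
    by (metis Gam.one_closed T.one_closed)
  with I one show "T.is_prime_ideal P"
    by (auto simp: T.is_prime_ideal_def)
next
  assume P: "T.is_prime_ideal P"
  then have I: "T.is_ideal P" and one: "\<one>\<^bsub>T\<^esub> \<notin> P"
    and prime: "\<And>a b. a \<in> carrier T \<Longrightarrow> b \<in> carrier T \<Longrightarrow> a \<otimes>\<^bsub>T\<^esub> b \<in> P \<Longrightarrow> a \<in> P \<or> b \<in> P"
    by (auto simp: T.is_prime_ideal_def)
  have u: "u \<gamma> \<notin> P" if "\<gamma> \<in> carrier \<Gamma>" for \<gamma>
    using T.is_ideal_mult[OF I, of "u \<gamma>" "inv\<^bsub>T\<^esub> (u \<gamma>)"] one u_Units[OF that] by auto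
  have "a \<in> P \<or> b \<in> P \<or> c \<in> P"
    if "a \<in> carrier T" "b \<in> carrier T" "c \<in> carrier T" "\<gamma> \<in> carrier \<Gamma>"
      "a \<otimes>\<^bsub>T\<^esub> b \<otimes>\<^bsub>T\<^esub> c \<otimes>\<^bsub>T\<^esub> u \<gamma> \<in> P" for a b c \<gamma>
    using that prime[of "a \<otimes>\<^bsub>T\<^esub> b \<otimes>\<^bsub>T\<^esub> c" "u \<gamma>"] prime[of "a \<otimes>\<^bsub>T\<^esub> b" c] prime[of a b]
      u[of \<gamma>] u_Units[of \<gamma>] by auto
  with I one show "prime_gamma_ideal \<Gamma> T u P"
    by (auto simp: prime_gamma_ideal_def gamma_ideal_iff ternary_def)
qed

text \<open>
  The Nullstellensatz for \<open>\<Gamma>\<close>-ideals: the hypothesis says that \<open>f\<close> lies in every prime above \<open>I\<close>.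
\<close>

lemma power_in_ideal_if_vanishing:
  assumes f: "f \<in> carrier T" and I: "T.is_ideal I"
    and van: "\<And>P. P \<in> principal_open \<Gamma> T u f \<Longrightarrow> \<not> I \<subseteq> P"
  shows "\<exists>s\<in>powers T f. s \<in> I"
proof (rule ccontr)
  assume "\<not> ?thesis"
  then obtain P where "T.is_prime_ideal P" "I \<subseteq> P" "f \<notin> P"
    using T.ex_prime_ideal_above[OF f I] by blast
  then show False
    using van[of P] by (simp add: principal_open_def gamma_Spec_def prime_gamma_ideal_iff)
qed

lemma saturation_if_principal_open_subset:
  assumes f: "f \<in> carrier T" and g: "g \<in> carrier T"
    and sub: "principal_open \<Gamma> T u g \<subseteq> principal_open \<Gamma> T u f"
  shows "f \<in> saturation T g"
proof -
  let ?I = "{f \<otimes>\<^bsub>T\<^esub> c |c. c \<in> carrier T}"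
  have "f \<in> ?I"
    using f by (force intro: exI[of _ "\<one>\<^bsub>T\<^esub>"])
  then have "\<exists>s\<in>powers T g. s \<in> ?I"
    using sub by (intro power_in_ideal_if_vanishing g T.is_ideal_principal f)
      (auto simp: principal_open_def)
  then show ?thesis
    using f by (auto intro: T.saturationI)
qed

text \<open>
  A prime avoiding \<open>fs i\<close> avoids its power \<open>g i\<close>, so no prime of the principal open of \<open>f\<close> contains the
  ideal spanned by the \<open>g i\<close>.
\<close>

lemma power_eq_combination_if_cover:
  assumes f: "f \<in> carrier T" and A: "finite A" and fs: "\<And>i. i \<in> A \<Longrightarrow> fs i \<in> carrier T"
    and cover: "principal_open \<Gamma> T u f \<subseteq> (\<Union>i\<in>A. principal_open \<Gamma> T u (fs i))"
    and g: "\<And>i. i \<in> A \<Longrightarrow> g i \<in> powers T (fs i)"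
  obtains b where "b \<in> A \<rightarrow> carrier T" "(\<Oplus>\<^bsub>T\<^esub>i\<in>A. b i \<otimes>\<^bsub>T\<^esub> g i) \<in> powers T f"
proof -
  let ?I = "{\<Oplus>\<^bsub>T\<^esub>i\<in>A. b i \<otimes>\<^bsub>T\<^esub> g i |b. b \<in> A \<rightarrow> carrier T}"
  have gC: "g \<in> A \<rightarrow> carrier T"
    using g fs T.powers_closed by blast
  have "\<exists>s\<in>powers T f. s \<in> ?I"
  proof (rule power_in_ideal_if_vanishing[OF f T.is_ideal_span[OF A gC]])
    fix P assume "P \<in> principal_open \<Gamma> T u f"
    then obtain i where i: "i \<in> A" and P: "P \<in> principal_open \<Gamma> T u (fs i)"
      using cover by blast
    then have "g i \<notin> P"
      using g[OF i] fs[OF i] T.powers_not_in_prime_ideal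
      by (auto simp: principal_open_def gamma_Spec_def prime_gamma_ideal_iff)
    with T.generator_in_span[OF A gC i] show "\<not> ?I \<subseteq> P" by blast
  qed
  then show ?thesis using that by auto
qed

text \<open>
  Equality up to a power of \<open>f\<close> is local: a combination of the local multipliers \<open>w i\<close> that is a
  power of \<open>f\<close> is a global multiplier.
\<close>

lemma cancel_if_cover:
  assumes f: "f \<in> carrier T" and A: "finite A" and fs: "\<And>i. i \<in> A \<Longrightarrow> fs i \<in> carrier T"
    and cover: "principal_open \<Gamma> T u f \<subseteq> (\<Union>i\<in>A. principal_open \<Gamma> T u (fs i))"
    and xy: "x \<in> carrier T" "y \<in> carrier T"
    and eq: "\<And>i. i \<in> A \<Longrightarrow> \<exists>w\<in>powers T (fs i). w \<otimes>\<^bsub>T\<^esub> x = w \<otimes>\<^bsub>T\<^esub> y"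
  shows "\<exists>w\<in>powers T f. w \<otimes>\<^bsub>T\<^esub> x = w \<otimes>\<^bsub>T\<^esub> y"
proof -
  obtain w where w: "\<And>i. i \<in> A \<Longrightarrow> w i \<in> powers T (fs i)"
    "\<And>i. i \<in> A \<Longrightarrow> w i \<otimes>\<^bsub>T\<^esub> x = w i \<otimes>\<^bsub>T\<^esub> y"
    using eq by metis
  have wC: "w i \<in> carrier T" if "i \<in> A" for i
    using that w(1) fs T.powers_closed by blast
  obtain b where b: "b \<in> A \<rightarrow> carrier T" and pow: "(\<Oplus>\<^bsub>T\<^esub>i\<in>A. b i \<otimes>\<^bsub>T\<^esub> w i) \<in> powers T f"
    using power_eq_combination_if_cover[OF f A fs cover w(1)] by blast
  have "(\<Oplus>\<^bsub>T\<^esub>i\<in>A. b i \<otimes>\<^bsub>T\<^esub> w i) \<otimes>\<^bsub>T\<^esub> x = (\<Oplus>\<^bsub>T\<^esub>i\<in>A. b i \<otimes>\<^bsub>T\<^esub> w i \<otimes>\<^bsub>T\<^esub> x)"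
    using A b wC xy by (intro T.finsum_ldistr) auto
  also have "\<dots> = (\<Oplus>\<^bsub>T\<^esub>i\<in>A. b i \<otimes>\<^bsub>T\<^esub> w i \<otimes>\<^bsub>T\<^esub> y)"
    using b wC w(2) xy by (intro T.finsum_cong') (auto simp: T.m_assoc Pi_iff)
  also have "\<dots> = (\<Oplus>\<^bsub>T\<^esub>i\<in>A. b i \<otimes>\<^bsub>T\<^esub> w i) \<otimes>\<^bsub>T\<^esub> y"
    using A b wC xy by (intro T.finsum_ldistr[symmetric]) auto
  finally show ?thesis using pow by blast
qed

end


section \<open>Gluing\<close>

context csemiring
begin

text \<open>
  Agreement on overlaps of fractions \<open>b\<^sub>i / s\<^sub>i\<close> gives \<open>b\<^sub>i s\<^sub>j = b\<^sub>j s\<^sub>i\<close> only up to a power of \<open>f\<^sub>i f\<^sub>j\<close>. As the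
  family is finite, one exponent \<open>K\<close> serves all pairs, and expanding each fraction by the \<open>K\<close>-th power
  of its \<open>f\<^sub>i\<close> moves that factor into the numerators and denominators.
\<close>

lemma common_denominators:
  assumes A: "finite A" and fs: "\<And>i. i \<in> A \<Longrightarrow> fs i \<in> carrier R"
    and sec: "\<And>i. i \<in> A \<Longrightarrow> sec i \<in> carrier (localization R (fs i))"
    and agree: "\<And>i j. i \<in> A \<Longrightarrow> j \<in> A \<Longrightarrow>
      restriction R (fs i) (fs i \<otimes> fs j) (sec i) = restriction R (fs j) (fs i \<otimes> fs j) (sec j)"
  shows "\<exists>a g. (\<forall>i\<in>A. a i \<in> carrier R \<and> g i \<in> powers R (fs i) \<and> sec i = frac R (fs i) (a i) (g i)) \<and>
    (\<forall>i\<in>A. \<forall>j\<in>A. a i \<otimes> g j = a j \<otimes> g i)"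
proof -
  have "\<exists>b s. b \<in> carrier R \<and> s \<in> powers R (fs i) \<and> sec i = frac R (fs i) b s"
    if "i \<in> A" for i
    using sec[OF that] by (rule localizationE) auto
  then obtain b s where b: "\<And>i. i \<in> A \<Longrightarrow> b i \<in> carrier R"
    and s: "\<And>i. i \<in> A \<Longrightarrow> s i \<in> powers R (fs i)"
    and sec_eq: "\<And>i. i \<in> A \<Longrightarrow> sec i = frac R (fs i) (b i) (s i)"
    by metis
  have sC: "s i \<in> carrier R" if "i \<in> A" for i
    using that s fs powers_closed by blast
  have "\<exists>k::nat. (fs i \<otimes> fs j) [^] k \<otimes> b i \<otimes> s j = (fs i \<otimes> fs j) [^] k \<otimes> b j \<otimes> s i"
    if i: "i \<in> A" and j: "j \<in> A" for i j
  proof -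
    have "fs i \<otimes> fs j \<in> powers R (fs i \<otimes> fs j)"
      using i j fs self_in_powers by blast
    then have "fs i \<in> saturation R (fs i \<otimes> fs j)" "fs j \<in> saturation R (fs i \<otimes> fs j)"
      using i j fs by (auto intro: saturationI[of _ "fs j"] saturationI[of _ "fs i"] simp: m_comm)
    then have "\<exists>w\<in>powers R (fs i \<otimes> fs j). w \<otimes> b i \<otimes> s j = w \<otimes> b j \<otimes> s i"
      using i j fs b s agree[OF i j] sec_eq
      by (intro equal_restrictions[of "fs i" "fs j"]) auto
    then show ?thesis by (auto simp: powers_def)
  qed
  then obtain k :: "_ \<Rightarrow> _ \<Rightarrow> nat" where k: "\<And>i j. i \<in> A \<Longrightarrow> j \<in> A \<Longrightarrow>
      (fs i \<otimes> fs j) [^] k i j \<otimes> b i \<otimes> s j = (fs i \<otimes> fs j) [^] k i j \<otimes> b j \<otimes> s i"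
    by metis
  \<comment> \<open>Any common upper bound of the exponents works; the sum is one also when \<open>A\<close> is empty.\<close>
  define K where "K = (\<Sum>i\<in>A. \<Sum>j\<in>A. k i j)"
  have K: "(fs i \<otimes> fs j) [^] K \<otimes> b i \<otimes> s j = (fs i \<otimes> fs j) [^] K \<otimes> b j \<otimes> s i"
    if i: "i \<in> A" and j: "j \<in> A" for i j
  proof -
    have "k i j \<le> (\<Sum>j\<in>A. k i j)"
      using A j by (intro member_le_sum) auto
    also have "\<dots> \<le> K"
      unfolding K_def using A i by (intro member_le_sum) auto
    finally obtain m where m: "K = m + k i j"
      by (metis le_iff_add add.commute)
    have split: "(fs i \<otimes> fs j) [^] K \<otimes> x \<otimes> y = (fs i \<otimes> fs j) [^] m \<otimes> ((fs i \<otimes> fs j) [^] k i j \<otimes> x \<otimes> y)"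
      if "x \<in> carrier R" "y \<in> carrier R" for x y
      using that i j fs unfolding m by (simp add: m_assoc flip: nat_pow_mult)
    note split[OF b[OF i] sC[OF j]]
    also note k[OF i j]
    also note split[OF b[OF j] sC[OF i], symmetric]
    finally show ?thesis .
  qed
  define a where "a i = fs i [^] K \<otimes> b i" for i
  define g where "g i = fs i [^] K \<otimes> s i" for i
  show ?thesis
  proof (intro exI conjI ballI)
    fix i assume i: "i \<in> A"
    show "a i \<in> carrier R"
      using i fs b by (simp add: a_def)
    show gi: "g i \<in> powers R (fs i)"
      unfolding g_def using i fs s powers_mult nat_pow_in_powers by blast
    have "\<one> \<otimes> b i \<otimes> g i = \<one> \<otimes> a i \<otimes> s i"
      using i fs b sC by (simp add: a_def g_def m_ac)
    then show "sec i = frac R (fs i) (a i) (g i)"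
      using i fs b s gi powers_one \<open>a i \<in> carrier R\<close>
      unfolding sec_eq[OF i] by (subst frac_eq_iff) blast+
  next
    fix i j assume ij: "i \<in> A" "j \<in> A"
    note C = ij[THEN fs] ij[THEN b] ij[THEN sC]
    have "a i \<otimes> g j = (fs i \<otimes> fs j) [^] K \<otimes> b i \<otimes> s j"
      using C by (simp add: a_def g_def nat_pow_distrib m_ac)
    also have "\<dots> = a j \<otimes> g i"
      unfolding K[OF ij] using C by (simp add: a_def g_def nat_pow_distrib m_ac)
    finally show "a i \<otimes> g j = a j \<otimes> g i" .
  qed
qed

end

context ternary_gamma_semiring
begin

text \<open>
  With a power \<open>q = \<Sum> b\<^sub>i g\<^sub>i\<close> of \<open>f\<close> as denominator, the same combination of the numerators
  is the glued section.
\<close>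

lemma gluing_exists:
  assumes f: "f \<in> carrier T" and A: "finite A" and fs: "\<And>i. i \<in> A \<Longrightarrow> fs i \<in> carrier T"
    and cover: "principal_open \<Gamma> T u f = (\<Union>i\<in>A. principal_open \<Gamma> T u (fs i))"
    and sec: "\<And>i. i \<in> A \<Longrightarrow> sec i \<in> carrier (localization T (fs i))"
    and agree: "\<And>i j. i \<in> A \<Longrightarrow> j \<in> A \<Longrightarrow>
      restriction T (fs i) (fs i \<otimes>\<^bsub>T\<^esub> fs j) (sec i) = restriction T (fs j) (fs i \<otimes>\<^bsub>T\<^esub> fs j) (sec j)"
  shows "\<exists>s\<in>carrier (localization T f). \<forall>i\<in>A. restriction T f (fs i) s = sec i"
proof -
  obtain a g where a: "\<And>i. i \<in> A \<Longrightarrow> a i \<in> carrier T"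
    and g: "\<And>i. i \<in> A \<Longrightarrow> g i \<in> powers T (fs i)"
    and sec_eq: "\<And>i. i \<in> A \<Longrightarrow> sec i = frac T (fs i) (a i) (g i)"
    and cross: "\<And>i j. i \<in> A \<Longrightarrow> j \<in> A \<Longrightarrow> a i \<otimes>\<^bsub>T\<^esub> g j = a j \<otimes>\<^bsub>T\<^esub> g i"
    using T.common_denominators[of A fs sec, OF A fs sec agree] by blast
  obtain b where b: "b \<in> A \<rightarrow> carrier T" and pow: "(\<Oplus>\<^bsub>T\<^esub>i\<in>A. b i \<otimes>\<^bsub>T\<^esub> g i) \<in> powers T f"
    using power_eq_combination_if_cover[of f A fs g, OF f A fs _ g] cover by blast
  have gC: "g i \<in> carrier T" if "i \<in> A" for i
    using that g fs T.powers_closed by blast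
  define x where "x = (\<Oplus>\<^bsub>T\<^esub>i\<in>A. b i \<otimes>\<^bsub>T\<^esub> a i)"
  define q where "q = (\<Oplus>\<^bsub>T\<^esub>i\<in>A. b i \<otimes>\<^bsub>T\<^esub> g i)"
  have x: "x \<in> carrier T" and q: "q \<in> carrier T"
    unfolding x_def q_def using a b gC by (auto intro!: T.finsum_closed)
  have "restriction T f (fs j) (frac T f x q) = sec j" if j: "j \<in> A" for j
  proof -
    have "x \<otimes>\<^bsub>T\<^esub> g j = (\<Oplus>\<^bsub>T\<^esub>i\<in>A. b i \<otimes>\<^bsub>T\<^esub> a i \<otimes>\<^bsub>T\<^esub> g j)"
      unfolding x_def using A a b j gC by (intro T.finsum_ldistr) auto
    also have "\<dots> = (\<Oplus>\<^bsub>T\<^esub>i\<in>A. b i \<otimes>\<^bsub>T\<^esub> g i \<otimes>\<^bsub>T\<^esub> a j)"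
    proof (rule T.finsum_cong')
      fix i assume i: "i \<in> A"
      have "b i \<otimes>\<^bsub>T\<^esub> (a i \<otimes>\<^bsub>T\<^esub> g j) = b i \<otimes>\<^bsub>T\<^esub> (g i \<otimes>\<^bsub>T\<^esub> a j)"
        unfolding cross[OF i j] using i j a gC by (simp add: T.m_comm)
      then show "b i \<otimes>\<^bsub>T\<^esub> a i \<otimes>\<^bsub>T\<^esub> g j = b i \<otimes>\<^bsub>T\<^esub> g i \<otimes>\<^bsub>T\<^esub> a j"
        using i j a b gC by (auto simp: T.m_assoc Pi_iff)
    qed (use a b gC j in \<open>auto simp: Pi_iff\<close>)
    also have "\<dots> = q \<otimes>\<^bsub>T\<^esub> a j"
      unfolding q_def using A a b j gC by (intro T.finsum_ldistr[symmetric]) auto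
    finally have "\<one>\<^bsub>T\<^esub> \<otimes>\<^bsub>T\<^esub> x \<otimes>\<^bsub>T\<^esub> g j = \<one>\<^bsub>T\<^esub> \<otimes>\<^bsub>T\<^esub> a j \<otimes>\<^bsub>T\<^esub> q"
      using x q a[OF j] by (simp add: T.m_comm)
    moreover have "f \<in> saturation T (fs j)"
      using cover j by (intro saturation_if_principal_open_subset f fs) auto
    ultimately show ?thesis
      using pow T.powers_one sec_eq[OF j] T.restriction_frac_eq_iff[OF f fs[OF j] _ x _ a[OF j] g[OF j]]
      unfolding q_def by auto
  qed
  with pow x show ?thesis
    unfolding q_def by (blast intro: T.frac_closed)
qed

text \<open>
  Two fractions are equal when their cross products agree up to a power of \<open>f\<close>, a condition that
  may be checked on the cover.
\<close>

lemma gluing_unique: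
  assumes f: "f \<in> carrier T" and A: "finite A" and fs: "\<And>i. i \<in> A \<Longrightarrow> fs i \<in> carrier T"
    and cover: "principal_open \<Gamma> T u f = (\<Union>i\<in>A. principal_open \<Gamma> T u (fs i))"
    and X: "X \<in> carrier (localization T f)" and Y: "Y \<in> carrier (localization T f)"
    and eq: "\<And>i. i \<in> A \<Longrightarrow> restriction T f (fs i) X = restriction T f (fs i) Y"
  shows "X = Y"
proof -
  obtain a s where a: "a \<in> carrier T" and s: "s \<in> powers T f" and X: "X = frac T f a s"
    using X by (rule T.localizationE)
  obtain b t where b: "b \<in> carrier T" and t: "t \<in> powers T f" and Y: "Y = frac T f b t"
    using Y by (rule T.localizationE)
  note C = a b T.powers_closed[OF f s] T.powers_closed[OF f t]
  have "\<exists>w\<in>powers T (fs i). w \<otimes>\<^bsub>T\<^esub> (a \<otimes>\<^bsub>T\<^esub> t) = w \<otimes>\<^bsub>T\<^esub> (b \<otimes>\<^bsub>T\<^esub> s)" if i: "i \<in> A" for i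
  proof -
    have "f \<in> saturation T (fs i)"
      using cover i by (intro saturation_if_principal_open_subset f fs) auto
    then have "\<exists>w\<in>powers T (fs i). w \<otimes>\<^bsub>T\<^esub> a \<otimes>\<^bsub>T\<^esub> t = w \<otimes>\<^bsub>T\<^esub> b \<otimes>\<^bsub>T\<^esub> s"
      using eq[OF i] f fs[OF i] a b s t unfolding X Y by (intro T.equal_restrictions[of f f])
    then show ?thesis
      using C T.powers_closed[OF fs[OF i]] by (auto simp: T.m_assoc)
  qed
  then have "\<exists>w\<in>powers T f. w \<otimes>\<^bsub>T\<^esub> (a \<otimes>\<^bsub>T\<^esub> t) = w \<otimes>\<^bsub>T\<^esub> (b \<otimes>\<^bsub>T\<^esub> s)"
    using cover C by (intro cancel_if_cover[OF f A fs]) auto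
  then show ?thesis
    unfolding X Y using f s t C T.powers_closed[OF f] by (auto simp: T.frac_eq_iff T.m_assoc)
qed

end

theorem theorem2:
  fixes \<Gamma> :: "('g, 'k) monoid_scheme"
    and T :: "('a, 'm) ring_scheme"
    and u :: "'g \<Rightarrow> 'a"
    and f :: 'a and fs :: "nat \<Rightarrow> 'a" and n :: nat
    and sec :: "nat \<Rightarrow> ('a \<times> 'a) set"
  assumes "ternary_gamma_semiring \<Gamma> T u"
    and "f \<in> carrier T"
    and "\<And>i. i \<in> {1..n} \<Longrightarrow> fs i \<in> carrier T"
    and "principal_open \<Gamma> T u f = (\<Union>i\<in>{1..n}. principal_open \<Gamma> T u (fs i))"
    and "\<And>i. i \<in> {1..n} \<Longrightarrow> sec i \<in> carrier (localization T (fs i))"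
    and "\<And>i j. i \<in> {1..n} \<Longrightarrow> j \<in> {1..n} \<Longrightarrow>
           restriction T (fs i) (fs i \<otimes>\<^bsub>T\<^esub> fs j) (sec i) =
           restriction T (fs j) (fs i \<otimes>\<^bsub>T\<^esub> fs j) (sec j)"
  shows "(\<exists>s\<in>carrier (localization T f). \<forall>i\<in>{1..n}. restriction T f (fs i) s = sec i) \<and>
         (\<forall>s\<in>carrier (localization T f). \<forall>t\<in>carrier (localization T f).
            (\<forall>i\<in>{1..n}. restriction T f (fs i) s = sec i) \<and>
            (\<forall>i\<in>{1..n}. restriction T f (fs i) t = sec i) \<longrightarrow> s = t)"
proof -
  interpret ternary_gamma_semiring \<Gamma> T u by fact
  have "\<exists>s\<in>carrier (localization T f). \<forall>i\<in>{1..n}. restriction T f (fs i) s = sec i"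
    by (rule gluing_exists[of f "{1..n}" fs sec, OF assms(2) _ assms(3-6)]) auto
  moreover have "s = t"
    if "s \<in> carrier (localization T f)" "t \<in> carrier (localization T f)"
      "\<forall>i\<in>{1..n}. restriction T f (fs i) s = sec i" "\<forall>i\<in>{1..n}. restriction T f (fs i) t = sec i"
    for s t
    by (rule gluing_unique[of f "{1..n}" fs s t, OF assms(2) _ assms(3,4)]) (use that in auto)
  ultimately show ?thesis by blast
qed

end
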